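(* Let $k>1$, $\nu\in\mathbb{R}^d$, let $\Sigma$ be a symmetric positive definite $d\times d$ matrix, and let $X\sim t_k(\nu,\Sigma)$ with density $p=t_k$. Put $\boldsymbol\tau_2(x)=\frac{1}{k-1}\left((x-\nu)(x-\nu)^T+k\Sigma\right)$. Then for all $g:\mathbb{R}^d\to\mathbb{R}$ in $\mathrm{dom}(p,\boldsymbol\tau_2)$, $$\mathbb{E}\left[\left((X-\nu)(X-\nu)^T+k\Sigma\right)\nabla g(X)\right]=(k-1)\,\mathbb{E}\left[(X-\nu)\,g(X)\right].$$
   Context: $t_k(\nu,\Sigma)$ is the multivariate Student distribution with $k$ degrees of freedom, with density on $\mathbb{R}^d$ $$t_k(x)=c_{k,d}\,|\Sigma|^{-1/2}\left[1+\frac{(x-\nu)^T\Sigma^{-1}(x-\nu)}{k}\right]^{-(k+d)/2},\qquad c_{k,d}=\frac{\Gamma((k+d)/2)}{\Gamma(k/2)\,k^{d/2}\,\pi^{d/2}} .$$ $\nabla g$ is a column vector. $\mathcal{F}_1(p)$ is the set of $\mathcal{C}^1$ functions $\varphi:\mathbb{R}^d\to\mathbb{R}$ such that $p\varphi$ has Lebesgue-integrable gradient and $\int_{\mathbb{R}^d}\partial_i(p\varphi)=0$ for $i=1,\dots,d$. For a matrix valued function $\mathbf{F}$ with all components in $\mathcal{F}_1(p)$, a scalar function $g$ belongs to $\mathrm{dom}(p,\mathbf{F})$ if $g$ is $\mathcal{C}^1$, all components of $\mathbf{F}g$ belong to $\mathcal{F}_1(p)$, and all components of $\mathbf{F}\,\partial_eg$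 are in $L^1(p)$ for every unit vector $e$. *)

theory Defs
  imports "HOL-Probability.Probability"
begin

definition dir_deriv :: "('a::euclidean_space \<Rightarrow> real) \<Rightarrow> 'a \<Rightarrow> 'a \<Rightarrow> real"
  where "dir_deriv f e x = frechet_derivative f (at x) e"

definition partial_deriv :: "(real^'d \<Rightarrow> real) \<Rightarrow> 'd::finite \<Rightarrow> real^'d \<Rightarrow> real"
  where "partial_deriv f i x = dir_deriv f (axis i 1) x"

definition gradient :: "(real^'d \<Rightarrow> real) \<Rightarrow> real^'d::finite \<Rightarrow> real^'d"
  where "gradient f x = (\<chi> i. partial_deriv f i x)"

definition C1_function :: "(real^'d::finite \<Rightarrow> real) \<Rightarrow> bool"
  where "C1_function f \<longleftrightarrow>
    (\<forall>x. f differentiable (at x)) \<and> (\<forall>i. continuous_on UNIV (partial_deriv f i))"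

definition sym_pos_def :: "real^'d^'d::finite \<Rightarrow> bool"
  where "sym_pos_def S \<longleftrightarrow>
    transpose S = S \<and> (\<forall>v. v \<noteq> 0 \<longrightarrow> v \<bullet> (S *v v) > 0)"

definition outer_square :: "real^'d \<Rightarrow> real^'d^'d::finite"
  where "outer_square v = (\<chi> i j. v $ i * v $ j)"

definition student_density :: "real \<Rightarrow> real^'d \<Rightarrow> real^'d^'d \<Rightarrow> real^'d::finite \<Rightarrow> real"
  where "student_density k \<nu> S x =
    (let d = real CARD('d);
         c = Gamma ((k + d) / 2) / (Gamma (k / 2) * k powr (d / 2) * pi powr (d / 2))
     in c * det S powr (- 1 / 2) *
        (1 + ((x - \<nu>) \<bullet> (matrix_inv S *v (x - \<nu>))) / k) powr (- (k + d) / 2))"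

text \<open>The class \<open>F\<^sub>1(p)\<close>. That \<open>p \<phi>\<close> has a gradient is read as (Frechet)
  differentiability at every point; it has to be required separately since \<open>p\<close> is an
  arbitrary function here and \<^const>\<open>frechet_derivative\<close> is total.\<close>

definition F1_class :: "(real^'d::finite \<Rightarrow> real) \<Rightarrow> (real^'d \<Rightarrow> real) set"
  where "F1_class p = {\<phi>. C1_function \<phi> \<and>
    (\<forall>x. (\<lambda>y. p y * \<phi> y) differentiable (at x)) \<and>
    (\<forall>i. integrable lborel (partial_deriv (\<lambda>y. p y * \<phi> y) i)) \<and>
    (\<forall>i. (LINT x|lborel. partial_deriv (\<lambda>y. p y * \<phi> y) i x) = 0)}"

text \<open>The class \<open>dom(p, F)\<close>, meant for matrix-valued \<open>F\<close> whose entries are all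
  in \<^term>\<open>F1_class p\<close>. This condition does not involve \<open>g\<close> and is not imposed here.
  \<open>L\<^sup>1(p)\<close> is integrability with respect to the measure with Lebesgue density \<open>p\<close>.\<close>

definition stein_dom :: "(real^'d::finite \<Rightarrow> real) \<Rightarrow> (real^'d \<Rightarrow> real^'n^'m) \<Rightarrow> (real^'d \<Rightarrow> real) set"
  where "stein_dom p F = {g. C1_function g \<and>
    (\<forall>i j. (\<lambda>x. F x $ i $ j * g x) \<in> F1_class p) \<and>
    (\<forall>e. norm e = 1 \<longrightarrow> (\<forall>i j.
       integrable (density lborel (\<lambda>x. ennreal (p x))) (\<lambda>x. F x $ i $ j * dir_deriv g e x)))}"

definition student_tau2 :: "real \<Rightarrow> real^'d \<Rightarrow> real^'d^'d \<Rightarrow> real^'d \<Rightarrow> real^'d^'d::finite"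
  where "student_tau2 k \<nu> S x = (1 / (k - 1)) *\<^sub>R (outer_square (x - \<nu>) + k *\<^sub>R S)"

end

theory Submission
  imports Defs
begin

text \<open>Write \<open>y = x - \<nu>\<close>. The density satisfies the Pearson-type system
  \<open>\<Sum>\<^sub>j \<partial>\<^sub>j (p \<tau>\<^sub>i\<^sub>j) = - p y\<^sub>i\<close>, because \<open>(y y\<^sup>T + k S) S\<inverse> y = (k + y\<^sup>T S\<inverse> y) y\<close> cancels
  the denominator of the logarithmic derivative of \<open>p\<close>. Hence
  \<open>\<Sum>\<^sub>j \<partial>\<^sub>j (p \<tau>\<^sub>i\<^sub>j g) = p (\<tau> \<nabla>g)\<^sub>i - p y\<^sub>i g\<close>; the left-hand side has integral zero and the first
  summand on the right is integrable, which gives both the integrability of \<open>p y\<^sub>i g\<close> and the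
  identity.\<close>

section \<open>Componentwise integration of vector-valued functions\<close>

lemma integrable_vec:
  fixes f :: "'a \<Rightarrow> real^'n::finite"
  assumes "\<And>i. integrable M (\<lambda>x. f x $ i)"
  shows "integrable M f"
proof -
  have "integrable M (\<lambda>x. \<Sum>i\<in>UNIV. f x $ i *\<^sub>R axis i (1::real))"
    using assms by (intro Bochner_Integration.integrable_sum integrable_scaleR_left) auto
  moreover have "(\<Sum>i\<in>UNIV. f x $ i *\<^sub>R axis i 1) = f x" for x
    using basis_expansion[of "f x"] by (simp add: scalar_mult_eq_scaleR)
  ultimately show ?thesis by simp
qed

lemma integral_vec_nth:
  fixes f :: "'a \<Rightarrow> real^'n::finite"
  assumes "integrable M f"
  shows "integral\<^sup>L M f $ i = (LINT x|M. f x $ i)"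
  using integral_bounded_linear[OF bounded_linear_vec_nth assms, of i] by simp

section \<open>Symmetric positive definite matrices and their inverses\<close>

lemma sym_pos_def_inner_commute:
  assumes "sym_pos_def S"
  shows "u \<bullet> (S *v v) = (S *v u) \<bullet> v"
  using assms dot_lmul_matrix[of u S v] vector_transpose_matrix[of u S]
  by (simp add: sym_pos_def_def)

lemma sym_pos_def_invertible:
  assumes "sym_pos_def S"
  shows "invertible S"
proof -
  \<comment> \<open>A kernel vector has \<open>v \<bullet> (S *v v) = 0\<close>, which positivity
    allows only for \<open>v = 0\<close>.\<close>
  have "v = 0" if "S *v v = 0" for v
    using assms that unfolding sym_pos_def_def by force
  then show ?thesis
    by (meson invertible_left_inverse matrix_left_invertible_ker)
qed

lemma sym_pos_def_mult_inv:
  assumes "sym_pos_def S"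
  shows "S *v (matrix_inv S *v v) = v"
proof -
  \<comment> \<open>\<open>matrix_inv\<close> is a Hilbert choice; invertibility supplies the
    witness for it.\<close>
  have "S ** matrix_inv S = mat 1"
    using sym_pos_def_invertible[OF assms] unfolding invertible_def matrix_inv_def
    by (rule someI2_ex) simp
  then show ?thesis
    by (simp add: matrix_vector_mul_assoc)
qed

text \<open>Substituting \<open>w = matrix_inv S *v v\<close> turns the form into
  \<open>w \<bullet> (S *v w)\<close>. This later keeps \<open>1 + Q / k\<close> and
  \<open>k + Q\<close> positive.\<close>

lemma sym_pos_def_inv_nonneg:
  assumes "sym_pos_def S"
  shows "0 \<le> v \<bullet> (matrix_inv S *v v)"
proof -
  let ?w = "matrix_inv S *v v"
  have "0 \<le> ?w \<bullet> (S *v ?w)"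
    using assms unfolding sym_pos_def_def by (cases "?w = 0") (auto intro: less_imp_le)
  then show ?thesis
    by (simp add: sym_pos_def_mult_inv[OF assms] inner_commute)
qed

lemma sym_pos_def_inv_inner_commute:
  assumes "sym_pos_def S"
  shows "u \<bullet> (matrix_inv S *v v) = (matrix_inv S *v u) \<bullet> v"
  by (metis assms sym_pos_def_inner_commute sym_pos_def_mult_inv)

section \<open>Derivatives of the density and of \<open>student_tau2\<close>, and the divergence
  identity\<close>

lemma student_density_nonneg:
  assumes "k > 0"
  shows "0 \<le> student_density k \<nu> S x"
  using assms unfolding student_density_def Let_def
  by (intro mult_nonneg_nonneg divide_nonneg_nonneg powr_ge_zero less_imp_le[OF Gamma_real_pos])
    auto

text \<open>Chain rule for a power of \<open>1 + Q / k\<close>. The result is written as the density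
  times its logarithmic derivative, with \<open>k + Q\<close> in the denominator, since
  \<open>student_tau2\<close> produces exactly this factor.\<close>

lemma student_density_has_derivative:
  fixes S :: "real^'d^'d::finite"
  assumes k: "k > 0" and S: "sym_pos_def S"
  shows "(student_density k \<nu> S has_derivative
    (\<lambda>v. - (k + real CARD('d)) * student_density k \<nu> S x
        / (k + (x - \<nu>) \<bullet> (matrix_inv S *v (x - \<nu>)))
        * ((matrix_inv S *v (x - \<nu>)) \<bullet> v))) (at x)"
proof -
  define A where "A = matrix_inv S"
  define Q where "Q x = (x - \<nu>) \<bullet> (A *v (x - \<nu>))" for x
  define d where "d = real CARD('d)"
  define c where "c = Gamma ((k + d) / 2) / (Gamma (k / 2) * k powr (d / 2) * pi powr (d / 2))
    * det S powr (- 1 / 2)"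
  have p: "student_density k \<nu> S = (\<lambda>x. c * (1 + Q x / k) powr (- (k + d) / 2))"
    by (simp add: fun_eq_iff student_density_def Let_def c_def Q_def A_def d_def)
  have "Q x \<ge> 0"
    unfolding Q_def A_def by (rule sym_pos_def_inv_nonneg[OF S])
  then have pos: "1 + Q x / k > 0"
    using k by (simp add: add_pos_nonneg)
  have "(Q has_derivative (\<lambda>v. (x - \<nu>) \<bullet> (A *v v) + v \<bullet> (A *v (x - \<nu>)))) (at x)"
    unfolding Q_def
    by (auto intro!: derivative_eq_intros bounded_linear.has_derivative[OF matrix_vector_mul_bounded_linear])
  \<comment> \<open>Symmetry of the inverse merges the two product-rule terms; the resulting 2
    cancels the half in the exponent.\<close>
  moreover have "(x - \<nu>) \<bullet> (A *v v) + v \<bullet> (A *v (x - \<nu>)) = 2 * ((A *v (x - \<nu>)) \<bullet> v)" for v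
    using sym_pos_def_inv_inner_commute[OF S, of "x - \<nu>" v] by (simp add: A_def inner_commute)
  ultimately have dQ: "(Q has_derivative (\<lambda>v. 2 * ((A *v (x - \<nu>)) \<bullet> v))) (at x)"
    by simp
  have "((\<lambda>x. c * (1 + Q x / k) powr (- (k + d) / 2)) has_derivative
    (\<lambda>v. c * ((- (k + d) / 2 * (1 + Q x / k) powr (- (k + d) / 2 - 1))
      * (2 * ((A *v (x - \<nu>)) \<bullet> v) / k)))) (at x)"
  proof -
    have "((\<lambda>t. t powr (- (k + d) / 2)) has_derivative
      (\<lambda>h. (- (k + d) / 2 * (1 + Q x / k) powr (- (k + d) / 2 - 1)) * h)) (at (1 + Q x / k))"
      using has_real_derivative_powr[OF pos, of "- (k + d) / 2"]
      unfolding has_field_derivative_def .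
    moreover have "((\<lambda>x. 1 + Q x / k) has_derivative (\<lambda>v. 2 * ((A *v (x - \<nu>)) \<bullet> v) / k)) (at x)"
      using k by (auto intro!: derivative_eq_intros dQ)
    ultimately show ?thesis
      by (intro has_derivative_mult_right) (rule has_derivative_compose)
  qed
  \<comment> \<open>Lowering the exponent by one divides by \<open>(k + Q x) / k\<close>; this extra
    \<open>k\<close> cancels the \<open>1 / k\<close> from the inner derivative.\<close>
  moreover have "(1 + Q x / k) powr (- (k + d) / 2 - 1)
      = (1 + Q x / k) powr (- (k + d) / 2) * k / (k + Q x)"
  proof -
    have "(1 + Q x / k) powr (- (k + d) / 2 - 1) = (1 + Q x / k) powr (- (k + d) / 2) / (1 + Q x / k)"
      using pos by (simp only: powr_diff powr_one)
    also have "1 + Q x / k = (k + Q x) / k"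
      using k by (simp add: field_simps)
    finally show ?thesis
      using k by (simp add: field_simps)
  qed
  ultimately show ?thesis
    unfolding p using k by (simp add: Q_def A_def d_def mult_ac)
qed

lemma student_tau2_nth_has_derivative:
  "((\<lambda>x. student_tau2 k \<nu> S x $ i $ j) has_derivative
    (\<lambda>v. ((x - \<nu>) $ i * v $ j + v $ i * (x - \<nu>) $ j) / (k - 1))) (at x)"
proof -
  have "((\<lambda>x. 1 / (k - 1) * ((x - \<nu>) $ i * (x - \<nu>) $ j + k * S $ i $ j)) has_derivative
    (\<lambda>v. 1 / (k - 1) * ((x - \<nu>) $ i * v $ j + v $ i * (x - \<nu>) $ j))) (at x)"
    by (intro has_derivative_mult_right)
      (auto intro!: derivative_eq_intros bounded_linear.has_derivative[OF bounded_linear_vec_nth])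
  then show ?thesis
    by (simp add: student_tau2_def outer_square_def)
qed

text \<open>With \<open>y = x - \<nu>\<close> and \<open>w = matrix_inv S *v y\<close>, the rank-one
  part sends \<open>w\<close> to \<open>(y \<bullet> w) *\<^sub>R y\<close> and \<open>S\<close>
  sends it back to \<open>y\<close>, so both contributions are parallel to \<open>y\<close>.\<close>

lemma student_tau2_mult_vec_inv:
  assumes "k \<noteq> 1" and S: "sym_pos_def S"
  shows "student_tau2 k \<nu> S x *v (matrix_inv S *v (x - \<nu>))
    = ((k + (x - \<nu>) \<bullet> (matrix_inv S *v (x - \<nu>))) / (k - 1)) *\<^sub>R (x - \<nu>)"
proof -
  let ?w = "matrix_inv S *v (x - \<nu>)"
  have "outer_square (x - \<nu>) *v ?w = ((x - \<nu>) \<bullet> ?w) *\<^sub>R (x - \<nu>)"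
    by (simp add: vec_eq_iff outer_square_def matrix_vector_mult_def inner_vec_def
        sum_distrib_left mult_ac)
  then show ?thesis
    by (simp add: student_tau2_def matrix_vector_mult_add_rdistrib sym_pos_def_mult_inv[OF S]
        scaleR_matrix_vector_assoc[symmetric] scaleR_add_left[symmetric] add.commute)
qed

lemma C1_function_has_derivative:
  assumes "C1_function g"
  shows "(g has_derivative (\<lambda>v. dir_deriv g v x)) (at x)"
  using assms frechet_derivative_works unfolding C1_function_def dir_deriv_def by auto

text \<open>The product rule gives three contributions. Differentiating \<open>g\<close> yields the
  gradient term; differentiating \<open>student_tau2\<close> and the density yields
  \<open>p g y\<close> with coefficients \<open>(d + 1) / (k - 1)\<close> and
  \<open>- (k + d) / (k - 1)\<close>, which add up to \<open>- 1\<close>.\<close>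

lemma student_tau2_divergence:
  fixes S :: "real^'d^'d::finite"
  assumes k: "k > 1" and S: "sym_pos_def S" and g: "C1_function g"
  shows "(\<Sum>j\<in>UNIV. partial_deriv
      (\<lambda>x. student_density k \<nu> S x * (student_tau2 k \<nu> S x $ i $ j * g x)) j x)
    = student_density k \<nu> S x * (student_tau2 k \<nu> S x *v gradient g x) $ i
      - student_density k \<nu> S x * (g x * (x - \<nu>) $ i)"
proof -
  have axis_nth_if: "axis j (1::real) $ i = (if j = i then 1 else 0)" for j
    by (simp add: axis_def)
  define y where "y = x - \<nu>"
  define p where "p = student_density k \<nu> S x"
  define T where "T = student_tau2 k \<nu> S x"
  define w where "w = matrix_inv S *v y"
  define d where "d = real CARD('d)"
  have Q: "k + y \<bullet> w > 0"
    using sym_pos_def_inv_nonneg[OF S, of y] k by (simp add: w_def)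
  let ?f = "\<lambda>j x. student_density k \<nu> S x * (student_tau2 k \<nu> S x $ i $ j * g x)"
  have summand: "partial_deriv (?f j) j x
    = p * (T $ i $ j * gradient g x $ j) + p * g x / (k - 1) * (y $ i + (if j = i then y $ j else 0))
      - (k + d) * p * g x / (k + y \<bullet> w) * (T $ i $ j * w $ j)" for j
  proof -
    have "(?f j has_derivative
      (\<lambda>v. p * (T $ i $ j * dir_deriv g v x + ((y $ i * v $ j + v $ i * y $ j) / (k - 1)) * g x)
        + (- (k + d) * p / (k + y \<bullet> w) * (w \<bullet> v)) * (T $ i $ j * g x))) (at x)"
      unfolding p_def T_def y_def w_def d_def
      using k S g
      by (intro has_derivative_mult student_density_has_derivative
          student_tau2_nth_has_derivative C1_function_has_derivative) auto
    \<comment> \<open>Uniqueness of the Frechet derivative allows evaluation at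
      \<open>axis j 1\<close>. The case split is needed because \<open>y $ i * y $ j\<close> has an
      additional derivative term on the diagonal.\<close>
    from fun_cong[OF frechet_derivative_at[OF this], of "axis j 1"] show ?thesis
      unfolding partial_deriv_def dir_deriv_def
      by (cases "j = i") (simp_all add: gradient_def partial_deriv_def dir_deriv_def inner_axis
          axis_nth_if algebra_simps add_divide_distrib diff_divide_distrib)
  qed
  \<comment> \<open>One \<open>y $ i\<close> per coordinate, plus one from the diagonal entry: hence
    \<open>d + 1\<close>.\<close>
  have "(\<Sum>j\<in>(UNIV::'d set). y $ i) + (\<Sum>j\<in>UNIV. if j = i then y $ j else 0) = (d + 1) * y $ i"
    by (simp add: d_def algebra_simps)
  moreover have "(\<Sum>j\<in>UNIV. T $ i $ j * w $ j) = (k + y \<bullet> w) / (k - 1) * y $ i"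
    using arg_cong[OF student_tau2_mult_vec_inv[OF _ S, of k \<nu> x], of "\<lambda>v. v $ i"] k
    by (simp add: T_def w_def y_def matrix_vector_mult_def)
  ultimately have "(\<Sum>j\<in>UNIV. partial_deriv (?f j) j x)
    = p * (T *v gradient g x) $ i + p * g x / (k - 1) * ((d + 1) * y $ i)
      - (k + d) * p * g x / (k + y \<bullet> w) * ((k + y \<bullet> w) / (k - 1) * y $ i)"
    unfolding summand
    by (simp only: sum.distrib sum_subtractf sum_distrib_left[symmetric] matrix_vector_mult_def
        vec_lambda_beta)
  also have "\<dots> = p * (T *v gradient g x) $ i
      + p * g x * y $ i * ((d + 1 - (k + d)) / (k - 1))"
  proof -
    have "(k + d) * p * g x / (k + y \<bullet> w) * ((k + y \<bullet> w) / (k - 1) * y $ i)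
        = p * g x * y $ i * ((k + d) / (k - 1))"
      using Q by simp
    then show ?thesis
      by (simp add: add_divide_distrib diff_divide_distrib algebra_simps)
  qed
  also have "(d + 1 - (k + d)) / (k - 1) = - 1"
    using k by (simp add: field_simps)
  finally show ?thesis
    by (simp add: p_def T_def y_def mult_ac)
qed

section \<open>Measurability, and the identity under Lebesgue measure\<close>

lemma C1_function_borel_measurable:
  assumes "C1_function g"
  shows "g \<in> borel_measurable borel" and "(\<lambda>x. gradient g x $ i) \<in> borel_measurable borel"
proof -
  have "continuous_on UNIV g"
    using assms unfolding C1_function_def
    by (auto intro!: continuous_at_imp_continuous_on differentiable_imp_continuous_within)
  then show "g \<in> borel_measurable borel"
    by (rule borel_measurable_continuous_onI)
  have "continuous_on UNIV (\<lambda>x. gradient g x $ i)"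
    using assms by (simp add: C1_function_def gradient_def)
  then show "(\<lambda>x. gradient g x $ i) \<in> borel_measurable borel"
    by (rule borel_measurable_continuous_onI)
qed

text \<open>Integrating the divergence identity one component at a time. Measurability of the
  density is a hypothesis here; in the application it is read off from
  \<open>distributed\<close>.\<close>

lemma student_stein_lborel:
  fixes S :: "real^'d^'d::finite"
  assumes k: "k > 1" and S: "sym_pos_def S"
    and p: "student_density k \<nu> S \<in> borel_measurable borel"
    and g: "g \<in> stein_dom (student_density k \<nu> S) (student_tau2 k \<nu> S)"
  shows "integrable lborel (\<lambda>x. student_density k \<nu> S x * (student_tau2 k \<nu> S x *v gradient g x) $ i)"
      (is "integrable _ ?G")
    and "integrable lborel (\<lambda>x. student_density k \<nu> S x * (g x * (x - \<nu>) $ i))"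
      (is "integrable _ ?H")
    and "(LINT x|lborel. student_density k \<nu> S x * (student_tau2 k \<nu> S x *v gradient g x) $ i)
      = (LINT x|lborel. student_density k \<nu> S x * (g x * (x - \<nu>) $ i))"
proof -
  define D where "D j x = partial_deriv
    (\<lambda>x. student_density k \<nu> S x * (student_tau2 k \<nu> S x $ i $ j * g x)) j x" for j x
  have C1: "C1_function g"
    using g by (simp add: stein_dom_def)
  have D: "integrable lborel (D j)" "integral\<^sup>L lborel (D j) = 0" for j
    using g by (simp_all add: stein_dom_def F1_class_def D_def[abs_def])
  have sumD: "(\<Sum>j\<in>UNIV. D j x) = ?G x - ?H x" for x
    unfolding D_def by (rule student_tau2_divergence[OF k S C1])
  have "integrable lborel
      (\<lambda>x. student_density k \<nu> S x * (student_tau2 k \<nu> S x $ i $ j * gradient g x $ j))" for j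
  proof -
    \<comment> \<open>The unit-vector condition of \<open>stein_dom\<close> is used with
      \<open>e = axis j 1\<close>, where the directional derivative is a gradient component.\<close>
    let ?f = "\<lambda>x. student_tau2 k \<nu> S x $ i $ j * dir_deriv g (axis j 1) x"
    have "integrable (density lborel (\<lambda>x. ennreal (student_density k \<nu> S x))) ?f"
      using g by (simp add: stein_dom_def norm_axis_1)
    moreover have "?f \<in> borel_measurable lborel"
      using borel_measurable_integrable[OF calculation] by simp
    ultimately show ?thesis
      using p k integrable_density[of ?f lborel "student_density k \<nu> S"] student_density_nonneg[of k \<nu> S]
      by (simp add: gradient_def partial_deriv_def)
  qed
  then have "integrable lborel (\<lambda>x. \<Sum>j\<in>UNIV.
      student_density k \<nu> S x * (student_tau2 k \<nu> S x $ i $ j * gradient g x $ j))"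
    by (rule Bochner_Integration.integrable_sum)
  then show G: "integrable lborel ?G"
    by (simp add: matrix_vector_mult_def sum_distrib_left)
  \<comment> \<open>The divergence identity is solved for \<open>?H\<close>, so that its
    integrability follows from that of \<open>?G\<close> and the \<open>D j\<close>.\<close>
  have "?H = (\<lambda>x. ?G x - (\<Sum>j\<in>UNIV. D j x))"
    by (simp add: sumD)
  then show H: "integrable lborel ?H"
    using G D(1) by simp
  have "integral\<^sup>L lborel ?G - integral\<^sup>L lborel ?H = (LINT x|lborel. (\<Sum>j\<in>UNIV. D j x))"
    using G H by (simp add: sumD)
  also have "\<dots> = 0"
    using D by (simp add: Bochner_Integration.integral_sum)
  finally show "integral\<^sup>L lborel ?G = integral\<^sup>L lborel ?H" by simp
qed

theorem mainTheorem10: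
  fixes k :: real and \<nu> :: "real^'d::finite" and S :: "real^'d^'d"
    and M :: "'w measure" and X :: "'w \<Rightarrow> real^'d" and g :: "real^'d \<Rightarrow> real"
  assumes "k > 1"
    and "sym_pos_def S"
    and "prob_space M"
    and "distributed M lborel X (\<lambda>x. ennreal (student_density k \<nu> S x))"
    and "g \<in> stein_dom (student_density k \<nu> S) (student_tau2 k \<nu> S)"
  shows "integrable M (\<lambda>\<omega>. (outer_square (X \<omega> - \<nu>) + k *\<^sub>R S) *v gradient g (X \<omega>))
    \<and> integrable M (\<lambda>\<omega>. g (X \<omega>) *\<^sub>R (X \<omega> - \<nu>))
    \<and> prob_space.expectation M (\<lambda>\<omega>. (outer_square (X \<omega> - \<nu>) + k *\<^sub>R S) *v gradient g (X \<omega>))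
      = (k - 1) *\<^sub>R prob_space.expectation M (\<lambda>\<omega>. g (X \<omega>) *\<^sub>R (X \<omega> - \<nu>))"
proof -
  let ?p = "student_density k \<nu> S" and ?T = "student_tau2 k \<nu> S"
  let ?F = "\<lambda>\<omega>. ?T (X \<omega>) *v gradient g (X \<omega>)" and ?H = "\<lambda>\<omega>. g (X \<omega>) *\<^sub>R (X \<omega> - \<nu>)"
  have C1: "C1_function g"
    using assms(5) by (simp add: stein_dom_def)
  \<comment> \<open>\<open>ennreal\<close> truncates negative values to 0; nonnegativity ensures
    that it loses nothing of the real density.\<close>
  have nonneg: "0 \<le> ?p x" for x
    using assms(1) by (simp add: student_density_nonneg)
  have p: "?p \<in> borel_measurable borel"
    using distributed_real_measurable[OF _ assms(4)] nonneg by simp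
  note stein = student_stein_lborel[OF assms(1,2) p assms(5)]
  have meas_T: "(\<lambda>x. ?T x $ i $ j) \<in> borel_measurable borel" for i j
    by (intro borel_measurable_continuous_onI continuous_at_imp_continuous_on ballI
        has_derivative_continuous[OF student_tau2_nth_has_derivative])
  have meas_G: "(\<lambda>x. (?T x *v gradient g x) $ i) \<in> borel_measurable lborel" for i
    using C1_function_borel_measurable(2)[OF C1] meas_T by (simp add: matrix_vector_mult_def)
  have meas_H: "(\<lambda>x. g x * (x - \<nu>) $ i) \<in> borel_measurable lborel" for i
    using C1_function_borel_measurable(1)[OF C1] by simp
  have "integrable M (\<lambda>\<omega>. ?F \<omega> $ i)" for i
    using distributed_integrable[OF assms(4) meas_G] nonneg stein(1) by simp
  then have F: "integrable M ?F"
    by (rule integrable_vec)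
  have "integrable M (\<lambda>\<omega>. ?H \<omega> $ i)" for i
    using distributed_integrable[OF assms(4) meas_H] nonneg stein(2) by simp
  then have H: "integrable M ?H"
    by (rule integrable_vec)
  have "(LINT \<omega>|M. ?F \<omega> $ i) = (LINT \<omega>|M. ?H \<omega> $ i)" for i
    using distributed_integral[OF assms(4) meas_G, of i] distributed_integral[OF assms(4) meas_H, of i]
      nonneg stein(3)[of i] by simp
  then have eq: "integral\<^sup>L M ?F = integral\<^sup>L M ?H"
    unfolding vec_eq_iff integral_vec_nth[OF F] integral_vec_nth[OF H] by blast
  \<comment> \<open>Undoing the normalisation \<open>1 / (k - 1)\<close> of
    \<open>student_tau2\<close> puts the factor \<open>k - 1\<close> on the right-hand side.\<close>
  have tau: "(outer_square (X \<omega> - \<nu>) + k *\<^sub>R S) *v gradient g (X \<omega>) = (k - 1) *\<^sub>R ?F \<omega>" for \<omega>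
    using assms(1) by (simp add: student_tau2_def scaleR_matrix_vector_assoc)
  show ?thesis
    using F H eq by (simp add: tau)
qed

end
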